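(* Let $n\ge2$ and use the notation of the context. Then the kernel $I^{fflv}$ of $\psi$ coincides with the kernel $I^{V_o,V_c}(\mathcal N)$ of $\theta$.
   Context: $R$ is the polynomial ring over $\mathbb{C}$ in the Plücker variables $X_{i_1,\ldots,i_k}$, $1\le k\le n-1$, $1\le i_1<\dots<i_k\le n$; for arbitrary distinct indices set $X_{i_{\sigma(1)},\ldots,i_{\sigma(k)}}=\mathrm{sgn}(\sigma)X_{i_1,\ldots,i_k}$. A one-column tableau $(\alpha_1,\ldots,\alpha_k)$ with entries in $[1,n]$ is PBW-semistandard if $\alpha_r\le k$ implies $\alpha_r=r$, and $r_1<r_2$, $\alpha_{r_1}>k$, $\alpha_{r_2}>k$ imply $\alpha_{r_1}>\alpha_{r_2}$. For each set $\{i_1<\dots<i_k\}$ there is exactly one such tableau with these entries; $\mathcal N$ is the set of symbols $b_{\alpha_1,\ldots,\alpha_k}$ over these tableaux, and $X_{b_{\alpha_1,\ldots,\alpha_k}}:=X_{\alpha_1,\ldots,\alpha_k}$. Let $P=\{(r,s):1\le r\le s\le n\}\setminus\{(1,1),(n,n)\}$ with $(r,s)\le(u,v)$ iff $r\le u$, $s\le v$. For an order ideal (lower set) $J$ of $P$ let $b(J)=b_{\alpha_1,\ldots,\alpha_k}$ where $k$ is the largest $l$ with $(l,l)\in J$ ($k=1$ if none), $\alpha_s=t$ for each maximal element $(s,t)$ of $J$, and $\alpha_r=r$ otherwise; $J\mapsto b(J)$ is a bijection from order ideals of $P$ onto $\mathcal N$, with inverse $\iota$. Let $V_o=\{(i,i):2\le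 i\le n-1\}$, $V_c=\{(r,s)\in P:r<s\}$, and for an order ideal $J$ let $K(J)=(J\cap V_o)\cup\{$maximal elements of $J$ lying in $V_c\}$. $\theta:R\to\mathbb{C}[z_p\,(p\in P),t]$ is $X_b\mapsto t\prod_{p\in K(\iota(b))}z_p$, and $I^{V_o,V_c}(\mathcal N)=\ker\theta$. $\psi:R\to\mathbb{C}[z_{i,j}\,(1\le i<j\le n),z_k\,(1\le k\le n-1)]$ sends $X_{\alpha_1,\ldots,\alpha_k}$, for $b_{\alpha_1,\ldots,\alpha_k}\in\mathcal N$, to $z_k\prod_{j:\alpha_j>k}z_{j,\alpha_j}$, and $I^{fflv}=\ker\psi$. *)

theory Defs
  imports
    "HOL-Library.Poly_Mapping"
    "HOL-Library.Product_Order"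
    "HOL-Combinatorics.Permutations"
    Complex_Main
begin

subsection \<open>Polynomial rings over the complex numbers\<close>

text \<open>
  The type below is the polynomial ring with one variable for every element of \<open>'v\<close>:
  finitely supported exponent vectors are mapped to coefficients, and multiplication is
  the convolution product of \<^theory>\<open>HOL-Library.Poly_Mapping\<close>.
\<close>

type_synonym 'v mpoly = "('v \<Rightarrow>\<^sub>0 nat) \<Rightarrow>\<^sub>0 complex"

definition Const :: "complex \<Rightarrow> 'v mpoly" where
  "Const c = Poly_Mapping.single 0 c"

definition Var :: "'v \<Rightarrow> 'v mpoly" where
  "Var v = Poly_Mapping.single (Poly_Mapping.single v 1) 1"

definition polys_in :: "'v set \<Rightarrow> 'v mpoly set" where
  "polys_in V = {p. \<forall>m \<in> Poly_Mapping.keys p. Poly_Mapping.keys m \<subseteq> V}"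

definition monom_subst :: "('v \<Rightarrow> 'w mpoly) \<Rightarrow> ('v \<Rightarrow>\<^sub>0 nat) \<Rightarrow> 'w mpoly" where
  "monom_subst f m = (\<Prod>v \<in> Poly_Mapping.keys m. f v ^ Poly_Mapping.lookup m v)"

definition poly_subst :: "('v \<Rightarrow> 'w mpoly) \<Rightarrow> 'v mpoly \<Rightarrow> 'w mpoly" where
  "poly_subst f p =
     (\<Sum>m \<in> Poly_Mapping.keys p. Const (Poly_Mapping.lookup p m) * monom_subst f m)"

lemma Const_0 [simp]: "Const 0 = 0"
  by (simp add: Const_def)

lemma Const_add: "Const (a + b) = Const a + Const b"
  by (simp add: Const_def single_add)

lemma Const_mult: "Const (a * b) = Const a * Const b"
  by (simp add: Const_def mult_single)

lemma monom_subst_superset: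
  assumes "finite A" "Poly_Mapping.keys m \<subseteq> A"
  shows "monom_subst f m = (\<Prod>v\<in>A. f v ^ Poly_Mapping.lookup m v)"
  unfolding monom_subst_def
  by (rule prod.mono_neutral_left) (use assms in \<open>auto simp: in_keys_iff\<close>)

lemma monom_subst_add: "monom_subst f (m + m') = monom_subst f m * monom_subst f m'"
proof -
  let ?A = "Poly_Mapping.keys m \<union> Poly_Mapping.keys m'"
  have "monom_subst f (m + m') = (\<Prod>v\<in>?A. f v ^ Poly_Mapping.lookup (m + m') v)"
    by (rule monom_subst_superset) (use keys_add[of m m'] in auto)
  also have "\<dots> = (\<Prod>v\<in>?A. f v ^ Poly_Mapping.lookup m v) * (\<Prod>v\<in>?A. f v ^ Poly_Mapping.lookup m' v)"
    by (simp add: lookup_add power_add prod.distrib)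
  also have "\<dots> = monom_subst f m * monom_subst f m'"
    by (simp add: monom_subst_superset[of ?A])
  finally show ?thesis .
qed

lemma poly_subst_superset:
  assumes "finite A" "Poly_Mapping.keys p \<subseteq> A"
  shows "poly_subst f p = (\<Sum>m\<in>A. Const (Poly_Mapping.lookup p m) * monom_subst f m)"
  unfolding poly_subst_def
  by (rule sum.mono_neutral_left) (use assms in \<open>auto simp: in_keys_iff\<close>)

lemma poly_subst_0 [simp]: "poly_subst f 0 = 0"
  by (simp add: poly_subst_def)

lemma poly_subst_add: "poly_subst f (p + q) = poly_subst f p + poly_subst f q"
proof -
  let ?A = "Poly_Mapping.keys p \<union> Poly_Mapping.keys q"
  have "poly_subst f (p + q) = (\<Sum>m\<in>?A. Const (Poly_Mapping.lookup (p + q) m) * monom_subst f m)"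
    by (rule poly_subst_superset) (use keys_add[of p q] in auto)
  then show ?thesis
    by (simp add: lookup_add Const_add algebra_simps sum.distrib poly_subst_superset[of ?A])
qed

lemma poly_subst_single: "poly_subst f (Poly_Mapping.single m c) = Const c * monom_subst f m"
  by (simp add: poly_subst_superset[of "{m}"])

lemma poly_subst_Const: "poly_subst f (Const c) = Const c"
  by (simp add: poly_subst_single Const_def[of c] monom_subst_def)

lemma poly_subst_Var: "poly_subst f (Var v) = f v"
  by (simp add: Var_def poly_subst_single monom_subst_def Const_def)

lemma poly_single_induct [case_names zero single add]:
  fixes p :: "'v mpoly"
  assumes "P 0" "\<And>m c. P (Poly_Mapping.single m c)" "\<And>p q. P p \<Longrightarrow> P q \<Longrightarrow> P (p + q)"
  shows "P p"
proof (induction p rule: update_induct)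
  case const
  then show ?case using assms(1) by simp
next
  case (update p a b)
  have "Poly_Mapping.update a b p = p + Poly_Mapping.single a b"
    by (rule poly_mapping_eqI)
      (use update in \<open>auto simp: lookup_update lookup_add lookup_single when_def in_keys_iff\<close>)
  then show ?case using assms update by simp
qed

lemma poly_subst_mult: "poly_subst f (p * q) = poly_subst f p * poly_subst f q"
proof (induction p rule: poly_single_induct)
  case (single m c)
  show ?case
    by (induction q rule: poly_single_induct)
      (simp_all add: mult_single poly_subst_single monom_subst_add Const_mult
        poly_subst_add algebra_simps)
qed (simp_all add: poly_subst_add algebra_simps)

subsection \<open>Pluecker variables and PBW-semistandard one-column tableaux\<close>

definition pluecker_index :: "nat \<Rightarrow> nat list set" where
  "pluecker_index n =
     {i. sorted_wrt (<) i \<and> set i \<subseteq> {1..n} \<and> 1 \<le> length i \<and> length i \<le> n - 1}"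

definition ring_R :: "nat \<Rightarrow> nat list mpoly set" where
  "ring_R n = polys_in (pluecker_index n)"

text \<open>
  If \<open>\<alpha> = (i\<^bsub>\<sigma>(1)\<^esub>, \<dots>, i\<^bsub>\<sigma>(k)\<^esub>)\<close> with \<open>i\<^sub>1 < \<dots> < i\<^sub>k\<close>, then the following is \<open>sgn \<sigma>\<close>.
  Only meaningful for lists of distinct entries, where \<open>\<sigma>\<close> is unique.
\<close>

definition sgn_list :: "nat list \<Rightarrow> int" where
  "sgn_list \<alpha> =
     sign (THE \<sigma>. \<sigma> permutes {..<length \<alpha>} \<and> \<alpha> = permute_list \<sigma> (sort \<alpha>))"

definition X_var :: "nat list \<Rightarrow> nat list mpoly" where
  "X_var \<alpha> = of_int (sgn_list \<alpha>) * Var (sort \<alpha>)"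

lemma X_var_permute:
  assumes i: "sorted_wrt (<) i" and s: "\<sigma> permutes {..<length i}"
  shows "X_var (permute_list \<sigma> i) = of_int (sign \<sigma>) * Var i"
proof -
  have dist: "distinct i" and sorted: "sorted i" using i by (simp_all add: strict_sorted_iff)
  have "mset (permute_list \<sigma> i) = mset i" using s by simp
  then have sort: "sort (permute_list \<sigma> i) = i"
    using sorted by (intro properties_for_sort) (simp_all only:)
  have "\<tau> = \<sigma>" if t: "\<tau> permutes {..<length i}" "permute_list \<sigma> i = permute_list \<tau> i" for \<tau>
  proof
    fix j show "\<tau> j = \<sigma> j"
    proof (cases "j < length i")
      case True
      then have "i ! \<sigma> j = i ! \<tau> j"
        using t(2) permute_list_nth[OF s True] permute_list_nth[OF t(1) True] by simp
      moreover have "\<sigma> j < length i" "\<tau> j < length i"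
        using True permutes_in_image[OF s] permutes_in_image[OF t(1)] by auto
      ultimately show ?thesis using dist by (simp add: nth_eq_iff_index_eq)
    next
      case False
      then show ?thesis using s t(1) by (simp add: permutes_def)
    qed
  qed
  then have "sgn_list (permute_list \<sigma> i) = sign \<sigma>"
    unfolding sgn_list_def sort length_permute_list
    by (intro arg_cong[where f = sign] the_equality conjI s refl) (elim conjE, blast)
  then show ?thesis by (simp add: X_var_def sort)
qed

definition entry :: "nat list \<Rightarrow> nat \<Rightarrow> nat" where
  "entry \<alpha> r = \<alpha> ! (r - 1)"  \<comment> \<open>entries are numbered from 1\<close>

definition pbw_semistandard :: "nat list \<Rightarrow> bool" where
  "pbw_semistandard \<alpha> \<longleftrightarrow>
     (let k = length \<alpha> in
       (\<forall>r \<in> {1..k}. entry \<alpha> r \<le> k \<longrightarrow> entry \<alpha> r = r) \<and>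
       (\<forall>r1 \<in> {1..k}. \<forall>r2 \<in> {1..k}.
          r1 < r2 \<and> entry \<alpha> r1 > k \<and> entry \<alpha> r2 > k \<longrightarrow> entry \<alpha> r1 > entry \<alpha> r2))"

text \<open>The symbol \<open>b\<^sub>\<alpha>\<close> is represented by the tableau \<open>\<alpha>\<close> itself.\<close>

definition symbols_N :: "nat \<Rightarrow> nat list set" where
  "symbols_N n = {\<alpha>. set \<alpha> \<subseteq> {1..n} \<and> 1 \<le> length \<alpha> \<and> length \<alpha> \<le> n - 1 \<and> pbw_semistandard \<alpha>}"

definition pbw_tableau :: "nat \<Rightarrow> nat list \<Rightarrow> nat list" where
  "pbw_tableau n i = (THE \<alpha>. \<alpha> \<in> symbols_N n \<and> sort \<alpha> = i)"

text \<open>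
  The homomorphism of algebras on \<open>ring_R n\<close> with \<open>X_var \<alpha> \<mapsto> f \<alpha>\<close> for all \<open>\<alpha> \<in> symbols_N n\<close>
  (see \<open>R_hom_X\<close> below). As \<open>X_var \<alpha>\<close> is plus or minus a variable, that variable has to be
  sent to the correspondingly signed \<open>f \<alpha>\<close>.
\<close>

definition R_hom :: "nat \<Rightarrow> (nat list \<Rightarrow> 'w mpoly) \<Rightarrow> nat list mpoly \<Rightarrow> 'w mpoly" where
  "R_hom n f =
     poly_subst (\<lambda>i. of_int (sgn_list (pbw_tableau n i)) * f (pbw_tableau n i))"

definition R_kernel :: "nat \<Rightarrow> (nat list mpoly \<Rightarrow> 'w mpoly) \<Rightarrow> nat list mpoly set" where
  "R_kernel n h = {p \<in> ring_R n. h p = 0}"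

lemma entry_in_set: "r \<in> {1..length \<alpha>} \<Longrightarrow> entry \<alpha> r \<in> set \<alpha>"
  by (auto simp: entry_def)

lemma in_set_entry: "x \<in> set \<alpha> \<Longrightarrow> \<exists>r \<in> {1..length \<alpha>}. x = entry \<alpha> r"
proof -
  assume "x \<in> set \<alpha>"
  then obtain i where "i < length \<alpha>" "x = \<alpha> ! i" by (auto simp: in_set_conv_nth)
  then show ?thesis by (intro bexI[of _ "Suc i"]) (auto simp: entry_def)
qed

lemma entry_ext:
  assumes "length \<alpha> = length \<beta>" "\<And>r. r \<in> {1..length \<alpha>} \<Longrightarrow> entry \<alpha> r = entry \<beta> r"
  shows "\<alpha> = \<beta>"
proof (rule nth_equalityI)
  fix i assume "i < length \<alpha>"
  then show "\<alpha> ! i = \<beta> ! i" using assms(2)[of "Suc i"] by (simp add: entry_def)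
qed (use assms in simp)

lemma pbw_entry_inj:
  assumes "pbw_semistandard \<alpha>" "r \<in> {1..length \<alpha>}" "s \<in> {1..length \<alpha>}"
    "entry \<alpha> r = entry \<alpha> s"
  shows "r = s"
proof -
  have fixp: "\<And>q. q \<in> {1..length \<alpha>} \<Longrightarrow> entry \<alpha> q \<le> length \<alpha> \<Longrightarrow> entry \<alpha> q = q"
    and dec: "\<And>p q. p \<in> {1..length \<alpha>} \<Longrightarrow> q \<in> {1..length \<alpha>} \<Longrightarrow> p < q \<Longrightarrow>
      entry \<alpha> p > length \<alpha> \<Longrightarrow> entry \<alpha> q > length \<alpha> \<Longrightarrow> entry \<alpha> p > entry \<alpha> q"
    using assms(1) unfolding pbw_semistandard_def Let_def by blast+
  show ?thesis
  proof (cases "entry \<alpha> r \<le> length \<alpha>")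
    case True
    then show ?thesis using fixp[of r] fixp[of s] assms by simp
  next
    case False
    then show ?thesis using dec[of r s] dec[of s r] assms by force
  qed
qed

lemma pbw_aux:
  assumes a: "pbw_semistandard \<alpha>" and b: "pbw_semistandard \<beta>"
    and set: "set \<alpha> = set \<beta>" and len: "length \<alpha> = length \<beta>"
    and r: "r \<in> {1..length \<alpha>}"
    and IH: "\<And>s. s < r \<Longrightarrow> s \<in> {1..length \<alpha>} \<Longrightarrow> entry \<alpha> s = entry \<beta> s"
  shows "entry \<beta> r \<le> entry \<alpha> r"
proof (rule ccontr)
  assume "\<not> entry \<beta> r \<le> entry \<alpha> r"
  then have lt: "entry \<alpha> r < entry \<beta> r" by simp
  let ?k = "length \<alpha>"
  have fixa: "\<And>q. q \<in> {1..?k} \<Longrightarrow> entry \<alpha> q \<le> ?k \<Longrightarrow> entry \<alpha> q = q"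
    and deca: "\<And>p q. p \<in> {1..?k} \<Longrightarrow> q \<in> {1..?k} \<Longrightarrow> p < q \<Longrightarrow>
      entry \<alpha> p > ?k \<Longrightarrow> entry \<alpha> q > ?k \<Longrightarrow> entry \<alpha> p > entry \<alpha> q"
    using a unfolding pbw_semistandard_def Let_def by blast+
  have fixb: "\<And>q. q \<in> {1..?k} \<Longrightarrow> entry \<beta> q \<le> ?k \<Longrightarrow> entry \<beta> q = q"
    using b len unfolding pbw_semistandard_def Let_def by auto
  have big: "entry \<alpha> r > ?k"
  proof (rule ccontr)
    assume "\<not> ?thesis"
    then have "entry \<alpha> r = r" using fixa r by simp
    then have "r \<in> set \<beta>" using entry_in_set[OF r] set by simp
    then obtain s where s: "s \<in> {1..?k}" "r = entry \<beta> s" using in_set_entry len by metis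
    then have "entry \<beta> s = s" using fixb[of s] r by auto
    then show False using s lt \<open>entry \<alpha> r = r\<close> by simp
  qed
  have "entry \<beta> r \<in> set \<alpha>" using entry_in_set[of r \<beta>] r len set by simp
  then obtain s where s: "s \<in> {1..?k}" "entry \<beta> r = entry \<alpha> s" using in_set_entry by metis
  consider "s < r" | "s = r" | "r < s" by linarith
  then show False
  proof cases
    case 1
    then have "entry \<beta> s = entry \<beta> r" using IH s by simp
    then show False using pbw_entry_inj[OF b, of s r] s r len 1 by simp
  next
    case 2
    then show False using s lt by simp
  next
    case 3
    then show False using deca[of r s] s r lt big by simp
  qed
qed

lemma pbw_unique:
  assumes "pbw_semistandard \<alpha>" "pbw_semistandard \<beta>" "sort \<alpha> = sort \<beta>"
  shows "\<alpha> = \<beta>"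
proof -
  have set: "set \<alpha> = set \<beta>" and len: "length \<alpha> = length \<beta>"
    using assms(3) by (metis set_sort, metis length_sort)
  have "r \<in> {1..length \<alpha>} \<longrightarrow> entry \<alpha> r = entry \<beta> r" for r
  proof (induction r rule: less_induct)
    case (less r)
    show ?case
    proof
      assume r: "r \<in> {1..length \<alpha>}"
      show "entry \<alpha> r = entry \<beta> r"
        using pbw_aux[OF assms(1,2) set len r] pbw_aux[OF assms(2,1) set[symmetric] len[symmetric], of r]
          less r len by (metis order_antisym)
    qed
  qed
  then show ?thesis using entry_ext[OF len] by blast
qed

lemma pbw_tableau_sort: "\<alpha> \<in> symbols_N n \<Longrightarrow> pbw_tableau n (sort \<alpha>) = \<alpha>"
  unfolding pbw_tableau_def
  by (rule the_equality) (auto simp: symbols_N_def intro: pbw_unique)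

lemma R_hom_X: "\<alpha> \<in> symbols_N n \<Longrightarrow> R_hom n f (X_var \<alpha>) = f \<alpha>"
proof -
  assume a: "\<alpha> \<in> symbols_N n"
  have "poly_subst g (of_int c) = of_int c" for g :: "nat list \<Rightarrow> 'a mpoly" and c
    using poly_subst_Const[of g "of_int c"] by (simp add: Const_def)
  moreover have "of_int (sgn_list \<alpha>) * of_int (sgn_list \<alpha>) = (1 :: 'a mpoly)"
    unfolding sgn_list_def of_int_mult[symmetric] by simp
  ultimately show ?thesis
    using a by (simp add: R_hom_def X_var_def poly_subst_mult poly_subst_Var pbw_tableau_sort
        flip: mult.assoc)
qed

subsection \<open>Order ideals of the poset \<open>P\<close>\<close>

text \<open>The order on pairs is the componentwise one of \<^theory>\<open>HOL-Library.Product_Order\<close>.\<close>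

definition poset_P :: "nat \<Rightarrow> (nat \<times> nat) set" where
  "poset_P n = {(r, s). 1 \<le> r \<and> r \<le> s \<and> s \<le> n} - {(1, 1), (n, n)}"

definition order_ideals :: "nat \<Rightarrow> (nat \<times> nat) set set" where
  "order_ideals n = {J. J \<subseteq> poset_P n \<and> (\<forall>q \<in> J. \<forall>p \<in> poset_P n. p \<le> q \<longrightarrow> p \<in> J)}"

definition maximals :: "(nat \<times> nat) set \<Rightarrow> (nat \<times> nat) set" where
  "maximals J = {p \<in> J. \<forall>q \<in> J. p \<le> q \<longrightarrow> q = p}"

definition ideal_length :: "(nat \<times> nat) set \<Rightarrow> nat" where
  "ideal_length J = (if \<exists>l. (l, l) \<in> J then Max {l. (l, l) \<in> J} else 1)"

definition ideal_tableau :: "(nat \<times> nat) set \<Rightarrow> nat list" where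
  "ideal_tableau J =
     map (\<lambda>r. if \<exists>t. (r, t) \<in> maximals J then THE t. (r, t) \<in> maximals J else r)
       [1..<ideal_length J + 1]"

definition \<iota> :: "nat \<Rightarrow> nat list \<Rightarrow> (nat \<times> nat) set" where
  "\<iota> n = the_inv_into (order_ideals n) ideal_tableau"

text \<open>\<open>ideal_tableau\<close> is indeed a bijection, so that \<open>\<iota>\<close> is its inverse.\<close>

definition tableau_ideal :: "nat \<Rightarrow> nat list \<Rightarrow> (nat \<times> nat) set" where
  "tableau_ideal n \<alpha> = {p \<in> poset_P n. p \<le> (length \<alpha>, length \<alpha>) \<or>
     (\<exists>r \<in> {1..length \<alpha>}. entry \<alpha> r > length \<alpha> \<and> p \<le> (r, entry \<alpha> r))}"

lemma finite_poset_P: "finite (poset_P n)"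
  by (rule finite_subset[of _ "{1..n} \<times> {1..n}"]) (auto simp: poset_P_def)

lemma poset_P_iff:
  "(r, s) \<in> poset_P n \<longleftrightarrow> 1 \<le> r \<and> r \<le> s \<and> s \<le> n \<and> (r, s) \<noteq> (1, 1) \<and> (r, s) \<noteq> (n, n)"
  by (auto simp: poset_P_def)

lemma length_ideal_tableau [simp]: "length (ideal_tableau J) = ideal_length J"
  by (simp add: ideal_tableau_def)

lemma maximals_unique:
  assumes "(r, t) \<in> maximals J" "(r', t') \<in> maximals J" "r \<le> r'" "t \<le> t'"
  shows "r = r' \<and> t = t'"
  using assms by (auto simp: maximals_def)

lemma maximals_unique_snd:
  assumes "(r, t) \<in> maximals J" "(r, t') \<in> maximals J"
  shows "t = t'"
  using assms maximals_unique[of r t J r t'] maximals_unique[of r t' J r t] by force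

lemma entry_ideal_tableau:
  assumes "r \<in> {1..ideal_length J}"
  shows "(r, t) \<in> maximals J \<Longrightarrow> entry (ideal_tableau J) r = t"
    and "(\<And>t. (r, t) \<notin> maximals J) \<Longrightarrow> entry (ideal_tableau J) r = r"
proof -
  have e: "entry (ideal_tableau J) r =
      (if \<exists>t. (r, t) \<in> maximals J then THE t. (r, t) \<in> maximals J else r)"
    using assms by (auto simp: entry_def ideal_tableau_def nth_append simp del: upt_Suc)
  show "(r, t) \<in> maximals J \<Longrightarrow> entry (ideal_tableau J) r = t"
    unfolding e using maximals_unique_snd by auto
  show "(\<And>t. (r, t) \<notin> maximals J) \<Longrightarrow> entry (ideal_tableau J) r = r"
    unfolding e by simp
qed

lemma maximals_above:
  assumes "finite J" "p \<in> J"
  shows "\<exists>q \<in> maximals J. p \<le> q"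
  using finite_has_maximal2[OF assms] unfolding maximals_def by blast

context
  fixes n J assumes n: "n \<ge> (2::nat)" and J: "J \<in> order_ideals n"
begin

lemma J_P: "p \<in> J \<Longrightarrow> p \<in> poset_P n"
  and J_down: "q \<in> J \<Longrightarrow> p \<in> poset_P n \<Longrightarrow> p \<le> q \<Longrightarrow> p \<in> J"
  using J by (auto simp: order_ideals_def)

lemma finite_J: "finite J"
  by (rule finite_subset[OF _ finite_poset_P[of n]]) (use J_P in blast)

lemma diag_bound: "(l, l) \<in> J \<Longrightarrow> 2 \<le> l \<and> l \<le> n - 1"
  using J_P[of "(l, l)"] by (auto simp: poset_P_iff)

lemma finite_diag: "finite {l. (l, l) \<in> J}"
  by (rule finite_subset[of _ "{..n}"]) (auto dest!: diag_bound)

lemma diag_le: "(l, l) \<in> J \<Longrightarrow> l \<le> ideal_length J"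
  using finite_diag by (auto simp: ideal_length_def)

lemma ideal_length_cases: "(ideal_length J, ideal_length J) \<in> J \<or> ideal_length J = 1"
  using Max_in[OF finite_diag] by (auto simp: ideal_length_def)

lemma ideal_length_bounds: "1 \<le> ideal_length J" "ideal_length J \<le> n - 1"
  using ideal_length_cases n by (auto dest!: diag_bound)

lemma fst_le: assumes "(s, t) \<in> J" shows "s \<le> ideal_length J"
proof (cases "s = 1")
  case True
  then show ?thesis using ideal_length_bounds by simp
next
  case False
  have p: "(s, t) \<in> poset_P n" using assms J_P by blast
  then have "(s, s) \<in> poset_P n" using False by (auto simp: poset_P_iff)
  moreover have "(s, s) \<le> (s, t)" using p by (auto simp: poset_P_iff)
  ultimately show ?thesis using J_down assms diag_le by blast
qed

lemma maximals_snd: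
  assumes m: "(s, t) \<in> maximals J"
  shows "t > ideal_length J \<or> (s = ideal_length J \<and> t = ideal_length J)"
proof -
  let ?k = "ideal_length J"
  have j: "(s, t) \<in> J" using m by (simp add: maximals_def)
  have s: "s \<le> ?k" using fst_le j .
  consider "(?k, ?k) \<in> J" | "?k = 1" using ideal_length_cases by blast
  then show ?thesis
  proof cases
    case 1
    show ?thesis
    proof (cases "t \<le> ?k")
      case True
      then have "(s, t) \<le> (?k, ?k)" using s by simp
      then have "(?k, ?k) = (s, t)" using m 1 by (auto simp: maximals_def)
      then show ?thesis by simp
    qed simp
  next
    case 2
    then show ?thesis using J_P[OF j] s by (auto simp: poset_P_iff)
  qed
qed

lemma ideal_tableau_entry_gt:
  assumes "r \<in> {1..ideal_length J}" "entry (ideal_tableau J) r > ideal_length J"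
  shows "(r, entry (ideal_tableau J) r) \<in> maximals J"
proof (cases "\<exists>t. (r, t) \<in> maximals J")
  case True
  then show ?thesis using entry_ideal_tableau(1)[OF assms(1)] by auto
next
  case False
  then show ?thesis using entry_ideal_tableau(2)[OF assms(1)] assms by auto
qed

lemma ideal_tableau_in_N: "ideal_tableau J \<in> symbols_N n"
proof -
  let ?k = "ideal_length J" and ?\<alpha> = "ideal_tableau J"
  have e: "entry ?\<alpha> r \<in> {1..n} \<and> (entry ?\<alpha> r \<le> ?k \<longrightarrow> entry ?\<alpha> r = r)"
    if r: "r \<in> {1..?k}" for r
  proof (cases "\<exists>t. (r, t) \<in> maximals J")
    case True
    then obtain t where t: "(r, t) \<in> maximals J" by blast
    then have "(r, t) \<in> poset_P n" using J_P by (auto simp: maximals_def)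
    then show ?thesis using entry_ideal_tableau(1)[OF r t] maximals_snd[OF t]
      by (auto simp: poset_P_iff)
  next
    case False
    then have "entry ?\<alpha> r = r" using entry_ideal_tableau(2)[OF r] by blast
    then show ?thesis using r ideal_length_bounds by auto
  qed
  have d: "entry ?\<alpha> r > entry ?\<alpha> s"
    if "r \<in> {1..?k}" "s \<in> {1..?k}" "r < s" "entry ?\<alpha> r > ?k" "entry ?\<alpha> s > ?k" for r s
    using maximals_unique[OF ideal_tableau_entry_gt[of r] ideal_tableau_entry_gt[of s]] that
    by force
  have "set ?\<alpha> \<subseteq> {1..n}" using in_set_entry[of _ ?\<alpha>] e by fastforce
  then show ?thesis
    using e d ideal_length_bounds unfolding symbols_N_def pbw_semistandard_def Let_def by auto
qed

lemma tableau_ideal_ideal_tableau: "tableau_ideal n (ideal_tableau J) = J"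
proof (intro equalityI subsetI)
  fix p assume "p \<in> J"
  then obtain r t where m: "(r, t) \<in> maximals J" "p \<le> (r, t)"
    using maximals_above[OF finite_J] by (metis surj_pair)
  then have j: "(r, t) \<in> J" by (simp add: maximals_def)
  have r: "r \<in> {1..ideal_length J}" using fst_le[OF j] J_P[OF j] by (auto simp: poset_P_iff)
  show "p \<in> tableau_ideal n (ideal_tableau J)"
    using maximals_snd[OF m(1)] entry_ideal_tableau(1)[OF r m(1)] r m(2) J_P[OF \<open>p \<in> J\<close>]
    unfolding tableau_ideal_def by force
next
  fix p assume p: "p \<in> tableau_ideal n (ideal_tableau J)"
  then have P: "p \<in> poset_P n" by (simp add: tableau_ideal_def)
  consider "p \<le> (ideal_length J, ideal_length J)"
    | r where "r \<in> {1..ideal_length J}" "entry (ideal_tableau J) r > ideal_length J"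
        "p \<le> (r, entry (ideal_tableau J) r)"
    using p by (auto simp: tableau_ideal_def)
  then show "p \<in> J"
  proof cases
    case 1
    then show ?thesis using ideal_length_cases J_down[OF _ P] P
      by (cases p) (auto simp: poset_P_iff)
  next
    case (2 r)
    then show ?thesis using ideal_tableau_entry_gt[of r] J_down[OF _ P]
      by (auto simp: maximals_def)
  qed
qed

end

context
  fixes n \<alpha> assumes n: "n \<ge> (2::nat)" and \<alpha>: "\<alpha> \<in> symbols_N n"
begin

lemma tableau_ideal_in: "tableau_ideal n \<alpha> \<in> order_ideals n"
  unfolding order_ideals_def tableau_ideal_def by (auto intro: order_trans)

lemma ideal_tableau_tableau_ideal: "ideal_tableau (tableau_ideal n \<alpha>) = \<alpha>"
proof -
  let ?k = "length \<alpha>" and ?J = "tableau_ideal n \<alpha>"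
  have k: "1 \<le> ?k" "?k \<le> n - 1" and set: "set \<alpha> \<subseteq> {1..n}"
    using \<alpha> by (auto simp: symbols_N_def)
  have fixp: "\<And>q. q \<in> {1..?k} \<Longrightarrow> entry \<alpha> q \<le> ?k \<Longrightarrow> entry \<alpha> q = q"
    and dec: "\<And>p q. p \<in> {1..?k} \<Longrightarrow> q \<in> {1..?k} \<Longrightarrow> p < q \<Longrightarrow>
      entry \<alpha> p > ?k \<Longrightarrow> entry \<alpha> q > ?k \<Longrightarrow> entry \<alpha> p > entry \<alpha> q"
    using \<alpha> unfolding symbols_N_def pbw_semistandard_def Let_def by blast+
  have diag: "(l, l) \<in> ?J \<longleftrightarrow> 2 \<le> l \<and> l \<le> ?k" for l
    using k n by (auto simp: tableau_ideal_def poset_P_iff)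
  have D: "{l. (l, l) \<in> ?J} = {2..?k}" unfolding diag by auto
  have len: "ideal_length ?J = ?k"
  proof (cases "?k = 1")
    case True
    then show ?thesis unfolding ideal_length_def diag by auto
  next
    case False
    then have "2 \<le> ?k" using k by simp
    moreover from this have "\<exists>l. (l, l) \<in> ?J" using diag by blast
    moreover from calculation(1) have "Max {2..?k} = ?k" by (intro Max_eqI) auto
    ultimately show ?thesis unfolding ideal_length_def D by simp
  qed
  have gtJ: "(r, entry \<alpha> r) \<in> ?J" if "r \<in> {1..?k}" "entry \<alpha> r > ?k" for r
    using that k set entry_in_set[of r \<alpha>] by (auto simp: tableau_ideal_def poset_P_iff)
  have gt: "(r, entry \<alpha> r) \<in> maximals ?J" if r: "r \<in> {1..?k}" "entry \<alpha> r > ?k" for r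
  proof -
    have "q = (r, entry \<alpha> r)" if q: "q \<in> ?J" "(r, entry \<alpha> r) \<le> q" for q
    proof -
      from q r obtain s where s: "s \<in> {1..?k}" "entry \<alpha> s > ?k" "q \<le> (s, entry \<alpha> s)"
        unfolding tableau_ideal_def by (cases q) auto
      then have "r \<le> s" "entry \<alpha> r \<le> entry \<alpha> s" using q(2) by (cases q; auto)+
      then have "r = s" using dec[OF r(1) s(1) _ r(2) s(2)] by force
      then show ?thesis using s(3) q(2) by (cases q) auto
    qed
    then show ?thesis using gtJ[OF r] unfolding maximals_def by blast
  qed
  have le: "t = r" if r: "r \<in> {1..?k}" "entry \<alpha> r \<le> ?k" and m: "(r, t) \<in> maximals ?J" for r t
  proof -
    have j: "(r, t) \<in> ?J" and P: "(r, t) \<in> poset_P n"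
      using m by (auto simp: maximals_def tableau_ideal_def)
    have "(r, t) \<le> (?k, ?k)"
    proof (rule ccontr)
      assume "\<not> ?thesis"
      then obtain s where s: "s \<in> {1..?k}" "entry \<alpha> s > ?k" "(r, t) \<le> (s, entry \<alpha> s)"
        using j by (auto simp: tableau_ideal_def)
      then have "(s, entry \<alpha> s) = (r, t)" using gtJ[OF s(1,2)] m by (auto simp: maximals_def)
      then show False using s r by auto
    qed
    moreover have "?k \<noteq> 1" using calculation P by (auto simp: poset_P_iff)
    ultimately have "(?k, ?k) = (r, t)" using diag[of ?k] k m by (auto simp: maximals_def)
    then show ?thesis by auto
  qed
  show ?thesis
  proof (rule entry_ext)
    fix r assume "r \<in> {1..length (ideal_tableau ?J)}"
    then have r: "r \<in> {1..?k}" and r': "r \<in> {1..ideal_length ?J}" using len by auto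
    show "entry (ideal_tableau ?J) r = entry \<alpha> r"
    proof (cases "entry \<alpha> r > ?k")
      case True
      then show ?thesis using entry_ideal_tableau(1)[OF r' gt[OF r]] by simp
    next
      case False
      then have "entry \<alpha> r = r" using fixp r by simp
      then show ?thesis using False entry_ideal_tableau[OF r'] le[OF r] by (metis not_less)
    qed
  qed (simp add: len)
qed

end

lemma ideal_tableau_bij:
  assumes "n \<ge> 2"
  shows "bij_betw ideal_tableau (order_ideals n) (symbols_N n)"
  using ideal_tableau_in_N[OF assms] tableau_ideal_ideal_tableau[OF assms]
    tableau_ideal_in[OF assms] ideal_tableau_tableau_ideal[OF assms]
  by (intro bij_betw_byWitness[where f' = "tableau_ideal n"]) auto

lemma \<iota>_inverse:
  assumes "n \<ge> 2" "\<alpha> \<in> symbols_N n"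
  shows "\<iota> n \<alpha> \<in> order_ideals n" "ideal_tableau (\<iota> n \<alpha>) = \<alpha>"
proof -
  have "inj_on ideal_tableau (order_ideals n)" "\<alpha> \<in> ideal_tableau ` order_ideals n"
    using ideal_tableau_bij[OF assms(1)] assms(2) by (simp_all add: bij_betw_def)
  then show "\<iota> n \<alpha> \<in> order_ideals n" "ideal_tableau (\<iota> n \<alpha>) = \<alpha>"
    unfolding \<iota>_def by (simp_all add: the_inv_into_into f_the_inv_into_f)
qed

definition V_o :: "nat \<Rightarrow> (nat \<times> nat) set" where
  "V_o n = {(i, i) | i. 2 \<le> i \<and> i \<le> n - 1}"

definition V_c :: "nat \<Rightarrow> (nat \<times> nat) set" where
  "V_c n = {(r, s) \<in> poset_P n. r < s}"

definition set_K :: "nat \<Rightarrow> (nat \<times> nat) set \<Rightarrow> (nat \<times> nat) set" where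
  "set_K n J = (J \<inter> V_o n) \<union> (maximals J \<inter> V_c n)"

subsection \<open>The two homomorphisms and their kernels\<close>

datatype theta_var = Z_P "nat \<times> nat" | Z_t

datatype psi_var = Z_pair nat nat | Z_single nat

definition \<theta> :: "nat \<Rightarrow> nat list mpoly \<Rightarrow> theta_var mpoly" where
  "\<theta> n = R_hom n (\<lambda>b. Var Z_t * (\<Prod>p \<in> set_K n (\<iota> n b). Var (Z_P p)))"

definition \<psi> :: "nat \<Rightarrow> nat list mpoly \<Rightarrow> psi_var mpoly" where
  "\<psi> n = R_hom n (\<lambda>\<alpha>. Var (Z_single (length \<alpha>)) *
     (\<Prod>j \<in> {j \<in> {1..length \<alpha>}. entry \<alpha> j > length \<alpha>}. Var (Z_pair j (entry \<alpha> j))))"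

definition I_Vo_Vc :: "nat \<Rightarrow> nat list mpoly set" where
  "I_Vo_Vc n = R_kernel n (\<theta> n)"

definition I_fflv :: "nat \<Rightarrow> nat list mpoly set" where
  "I_fflv n = R_kernel n (\<psi> n)"

end

theory Submission
  imports Defs
begin

text \<open>
  Up to sign, both homomorphisms send Pluecker variables to monomials, with the same signs, so
  each kernel only depends on which monomials of \<open>R\<close> receive equal exponent vectors.
  For a tableau \<open>\<alpha>\<close> of length \<open>k\<close> one has
  \<open>K(\<iota>(\<alpha>)) = {(i,i) | 2 \<le> i \<le> k} \<union> {(j,\<alpha>\<^sub>j) | \<alpha>\<^sub>j > k}\<close>. Hence the exponents of \<open>z\<^bsub>j,s\<^esub>\<close>, \<open>j < s\<close>, agree
  on both sides, while the exponents of \<open>t, z\<^bsub>2,2\<^esub>, z\<^bsub>3,3\<^esub>, \<dots>\<close> under \<open>\<theta>\<close> are the partial sums,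
  from the top, of those of \<open>z\<^sub>1, z\<^sub>2, \<dots>\<close> under \<open>\<psi>\<close>; each family determines the other.
\<close>

subsection \<open>Substitution of monomials\<close>

text \<open>The inner constant sum encodes the scalar multiple of \<open>e v\<close> by its
  exponent, so this is the additive extension of \<open>e\<close> from variables to exponent
  vectors.\<close>

definition monom_exp :: "('v \<Rightarrow> 'w \<Rightarrow>\<^sub>0 nat) \<Rightarrow> ('v \<Rightarrow>\<^sub>0 nat) \<Rightarrow> 'w \<Rightarrow>\<^sub>0 nat" where
  "monom_exp e m = (\<Sum>v\<in>Poly_Mapping.keys m. \<Sum>_<Poly_Mapping.lookup m v. e v)"

lemma lookup_monom_exp:
  "Poly_Mapping.lookup (monom_exp e m) w =
     (\<Sum>v\<in>Poly_Mapping.keys m. Poly_Mapping.lookup m v * Poly_Mapping.lookup (e v) w)"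
  by (simp add: monom_exp_def lookup_sum)

lemma single_power:
  fixes a :: "'w \<Rightarrow>\<^sub>0 nat" and c :: complex
  shows "Poly_Mapping.single a c ^ k = Poly_Mapping.single (\<Sum>_<k. a) (c ^ k)"
  by (induction k) (simp_all add: mult_single add.commute)

lemma prod_single:
  fixes a :: "'v \<Rightarrow> 'w \<Rightarrow>\<^sub>0 nat" and c :: "'v \<Rightarrow> complex"
  assumes "finite A"
  shows "(\<Prod>v\<in>A. Poly_Mapping.single (a v) (c v)) = Poly_Mapping.single (\<Sum>v\<in>A. a v) (\<Prod>v\<in>A. c v)"
  using assms by (induction A) (simp_all add: mult_single)

lemma prod_Var:
  assumes "finite A"
  shows "(\<Prod>v\<in>A. Var (g v)) = Poly_Mapping.single (\<Sum>v\<in>A. Poly_Mapping.single (g v) 1) 1"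
  using prod_single[OF assms, of "\<lambda>v. Poly_Mapping.single (g v) 1" "\<lambda>_. 1"]
  by (simp add: Var_def)

lemma of_int_mult_single:
  fixes a :: "'w \<Rightarrow>\<^sub>0 nat" and c :: complex
  shows "of_int z * Poly_Mapping.single a c = Poly_Mapping.single a (of_int z * c)"
proof -
  have "of_int z = (Poly_Mapping.single 0 (of_int z) :: ('w \<Rightarrow>\<^sub>0 nat) \<Rightarrow>\<^sub>0 complex)"
    by simp
  then show ?thesis
    by (metis add_0 mult_single)
qed

lemma monom_subst_single:
  "monom_subst (\<lambda>v. Poly_Mapping.single (e v) (c v)) m =
     Poly_Mapping.single (monom_exp e m)
       (\<Prod>v\<in>Poly_Mapping.keys m. c v ^ Poly_Mapping.lookup m v)"
  by (simp add: monom_subst_def monom_exp_def single_power prod_single)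

lemma lookup_poly_subst_single:
  "Poly_Mapping.lookup (poly_subst (\<lambda>v. Poly_Mapping.single (e v) (c v)) p) a =
     (\<Sum>m\<in>{m \<in> Poly_Mapping.keys p. monom_exp e m = a}. Poly_Mapping.lookup p m *
        (\<Prod>v\<in>Poly_Mapping.keys m. c v ^ Poly_Mapping.lookup m v))"
  by (simp add: poly_subst_def monom_subst_single Const_def mult_single lookup_sum lookup_single
      when_def sum.inter_filter)

text \<open>By \<open>lookup_poly_subst_single\<close>, each coefficient of the image is a sum over
  one fibre of \<open>monom_exp e\<close>, and its weights depend on \<open>c\<close> but not on
  \<open>e\<close>. As \<open>e\<close> and \<open>e'\<close> split the monomials of
  \<open>p\<close> into the same fibres, every nonempty fibre sum for \<open>e'\<close> is also one
  for \<open>e\<close>.\<close>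

lemma poly_subst_single_eq_0_mono:
  assumes eq: "\<And>m m'. m \<in> Poly_Mapping.keys p \<Longrightarrow> m' \<in> Poly_Mapping.keys p \<Longrightarrow>
      monom_exp e m = monom_exp e m' \<longleftrightarrow> monom_exp e' m = monom_exp e' m'"
    and z: "poly_subst (\<lambda>v. Poly_Mapping.single (e v) (c v)) p = 0"
  shows "poly_subst (\<lambda>v. Poly_Mapping.single (e' v) (c v)) p = 0"
proof (rule poly_mapping_eqI)
  fix a
  let ?F = "\<lambda>e a. {m \<in> Poly_Mapping.keys p. monom_exp e m = a}"
  show "Poly_Mapping.lookup (poly_subst (\<lambda>v. Poly_Mapping.single (e' v) (c v)) p) a =
      Poly_Mapping.lookup 0 a"
  proof (cases "?F e' a = {}")
    case True
    then show ?thesis by (simp only: lookup_poly_subst_single) simp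
  next
    case False
    then obtain m where m: "m \<in> Poly_Mapping.keys p" "monom_exp e' m = a" by blast
    have "?F e' a = ?F e (monom_exp e m)"
      by (intro Collect_cong conj_cong refl) (use eq[OF _ m(1)] m(2) in simp)
    then show ?thesis
      using lookup_poly_subst_single[of e c p "monom_exp e m"] z
      by (simp only: lookup_poly_subst_single) simp
  qed
qed

lemma poly_subst_single_eq_0_iff:
  assumes "\<And>m m'. m \<in> Poly_Mapping.keys p \<Longrightarrow> m' \<in> Poly_Mapping.keys p \<Longrightarrow>
      monom_exp e m = monom_exp e m' \<longleftrightarrow> monom_exp e' m = monom_exp e' m'"
  shows "poly_subst (\<lambda>v. Poly_Mapping.single (e v) (c v)) p = 0 \<longleftrightarrow>
    poly_subst (\<lambda>v. Poly_Mapping.single (e' v) (c v)) p = 0"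
  using poly_subst_single_eq_0_mono[of p e e' c] poly_subst_single_eq_0_mono[of p e' e c] assms
  by blast

subsection \<open>Existence of PBW-semistandard tableaux\<close>

text \<open>Each entry at most \<open>k\<close> stays at its own position; the entries above
  \<open>k\<close> fill the gaps in decreasing order. Existence is what makes the definite
  description in \<open>pbw_tableau\<close> meaningful.\<close>

lemma pbw_tableau_exists:
  assumes i: "i \<in> pluecker_index n"
  shows "\<exists>\<alpha> \<in> symbols_N n. sort \<alpha> = i"
proof -
  let ?k = "length i"
  define S where "S = set i"
  define G where "G = {1..?k} - S"
  define B where "B = rev (sorted_list_of_set (S - {1..?k}))"
  \<comment> \<open>The rank of a gap among all gaps, counted from 0 because it indexes
    \<open>B\<close>.\<close>
  define pos where "pos r = card {q \<in> G. q < r}" for r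
  define \<alpha> where "\<alpha> = map (\<lambda>r. if r \<in> S then r else B ! pos r) [1..<?k + 1]"
  have si: "sorted i" "distinct i" and Sn: "S \<subseteq> {1..n}" and k: "1 \<le> ?k" "?k \<le> n - 1"
    using i by (simp_all add: pluecker_index_def strict_sorted_iff S_def)
  have fin: "finite S" "finite G" by (simp_all add: S_def G_def)
  have cS: "card S = ?k" unfolding S_def using si by (simp add: distinct_card)
  \<comment> \<open>\<open>S\<close> and \<open>{1..k}\<close> both have \<open>k\<close> elements,
    so removing their common part leaves equally many large entries and gaps.\<close>
  have lenB: "length B = card G"
  proof -
    have "card (S - {1..?k}) + card (S \<inter> {1..?k}) = card S"
      using fin by (metis Int_commute add.commute card_Diff_subset_Int card_Int_Diff finite_Int)
    moreover have "card G + card (S \<inter> {1..?k}) = card {1..?k}"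
      unfolding G_def by (metis Int_commute add.commute card_Int_Diff finite_atLeastAtMost)
    ultimately show ?thesis using cS by (simp add: B_def)
  qed
  have pos_less: "pos r < pos s" if "r \<in> G" "r < s" for r s
    unfolding pos_def by (rule psubset_card_mono) (use that fin in auto)
  have pos_lt: "pos r < length B" if "r \<in> G" for r
    unfolding pos_def lenB by (rule psubset_card_mono) (use that fin in auto)
  have setB: "set B = S - {1..?k}" using fin by (simp add: B_def)
  have decB: "B ! a > B ! b" if "a < b" "b < length B" for a b
  proof -
    have "sorted_wrt (>) B"
      unfolding B_def sorted_wrt_rev by (simp add: strict_sorted_list_of_set)
    then show ?thesis using that by (rule sorted_wrt_nth_less)
  qed
  have B_gt: "B ! pos r \<in> S \<and> B ! pos r > ?k" if "r \<in> G" for r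
    using nth_mem[OF pos_lt[OF that]] setB Sn by force
  have len: "length \<alpha> = ?k" by (simp add: \<alpha>_def del: upt_Suc)
  have e: "entry \<alpha> r = (if r \<in> S then r else B ! pos r)" if "r \<in> {1..?k}" for r
    using that by (auto simp: \<alpha>_def entry_def simp del: upt_Suc)
  have eS: "entry \<alpha> r \<in> S \<and> (entry \<alpha> r \<le> ?k \<longrightarrow> r \<in> S)" if "r \<in> {1..?k}" for r
    using that B_gt[of r] e[OF that] by (auto simp: G_def)
  have dec: "entry \<alpha> r > entry \<alpha> s"
    if "r \<in> {1..?k}" "s \<in> {1..?k}" "r < s" "entry \<alpha> r > ?k" "entry \<alpha> s > ?k" for r s
  proof -
    have "r \<in> G" "s \<in> G" using that e[of r] e[of s] by (auto simp: G_def split: if_splits)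
    then show ?thesis using that e[of r] e[of s] decB[OF pos_less pos_lt] by (simp add: G_def)
  qed
  have pbw: "pbw_semistandard \<alpha>"
    unfolding pbw_semistandard_def Let_def len using eS e dec by (metis (no_types, lifting))
  have sub: "set \<alpha> \<subseteq> S" using in_set_entry[of _ \<alpha>] eS len by fastforce
  have dist: "distinct \<alpha>"
  proof (unfold distinct_conv_nth, intro allI impI)
    fix a b assume "a < length \<alpha>" "b < length \<alpha>" "a \<noteq> b"
    then show "\<alpha> ! a \<noteq> \<alpha> ! b"
      using pbw_entry_inj[OF pbw, of "Suc a" "Suc b"] by (auto simp: entry_def)
  qed
  have "set \<alpha> = S"
    by (rule card_subset_eq) (use fin sub len cS distinct_card[OF dist] in auto)
  then have "sort \<alpha> = i"
    using si dist by (intro sorted_distinct_set_unique) (auto simp: S_def)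
  moreover have "\<alpha> \<in> symbols_N n"
    using sub Sn len k pbw by (auto simp: symbols_N_def)
  ultimately show ?thesis by blast
qed

lemma pbw_tableau_in_N: "i \<in> pluecker_index n \<Longrightarrow> pbw_tableau n i \<in> symbols_N n"
  using pbw_tableau_exists pbw_tableau_sort by metis

subsection \<open>Comparison of the exponents\<close>

lemma finite_set_K: "finite (set_K n J)"
  by (rule finite_subset[of _ "{1..n} \<times> {1..n}"])
    (auto simp: set_K_def V_o_def V_c_def poset_P_iff)

text \<open>\<open>ideal_length\<close> is the top diagonal index of the lower set \<open>J\<close>,
  so the diagonal part is a full initial segment. Maximal elements off the diagonal lie in columns
  beyond \<open>k\<close>, and the tableau records them as its entries above
  \<open>k\<close>.\<close>

lemma set_K_\<iota>:
  assumes n: "n \<ge> 2" and \<alpha>: "\<alpha> \<in> symbols_N n"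
  shows "set_K n (\<iota> n \<alpha>) = {(l, l) | l. 2 \<le> l \<and> l \<le> length \<alpha>} \<union>
    {(j, entry \<alpha> j) | j. j \<in> {1..length \<alpha>} \<and> entry \<alpha> j > length \<alpha>}"
proof -
  define J where "J = \<iota> n \<alpha>"
  have J: "J \<in> order_ideals n" and a: "ideal_tableau J = \<alpha>"
    using \<iota>_inverse[OF n \<alpha>] by (simp_all add: J_def)
  have len: "ideal_length J = length \<alpha>" using a length_ideal_tableau by metis
  have k: "length \<alpha> \<le> n - 1" using ideal_length_bounds[OF n J] len by simp
  have "J \<inter> V_o n = {(l, l) | l. 2 \<le> l \<and> l \<le> length \<alpha>}"
  proof (intro equalityI subsetI)
    fix p assume "p \<in> J \<inter> V_o n"
    then show "p \<in> {(l, l) | l. 2 \<le> l \<and> l \<le> length \<alpha>}"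
      using diag_le[OF n J] len by (auto simp: V_o_def)
  next
    fix p assume "p \<in> {(l, l) | l. 2 \<le> l \<and> l \<le> length \<alpha>}"
    then obtain l where l: "p = (l, l)" "2 \<le> l" "l \<le> length \<alpha>" by blast
    \<comment> \<open>The default length 1 of an ideal without diagonal elements is excluded by
      \<open>2 \<le> l\<close>.\<close>
    then have "(length \<alpha>, length \<alpha>) \<in> J" using ideal_length_cases[OF n J] len by auto
    moreover have "(l, l) \<in> poset_P n" using l k n by (auto simp: poset_P_iff)
    ultimately have "(l, l) \<in> J" using J_down[OF n J] l by auto
    then show "p \<in> J \<inter> V_o n" using l k by (auto simp: V_o_def)
  qed
  moreover have "maximals J \<inter> V_c n =
      {(j, entry \<alpha> j) | j. j \<in> {1..length \<alpha>} \<and> entry \<alpha> j > length \<alpha>}"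
  proof (intro equalityI subsetI)
    fix p assume p: "p \<in> maximals J \<inter> V_c n"
    obtain r t where rt: "p = (r, t)" by fastforce
    have m: "(r, t) \<in> maximals J" and P: "(r, t) \<in> poset_P n" "r < t"
      using p rt by (auto simp: V_c_def)
    have "r \<le> length \<alpha>" using m fst_le[OF n J, of r t] len by (simp add: maximals_def)
    then have r: "r \<in> {1..ideal_length J}" using P len by (auto simp: poset_P_iff)
    show "p \<in> {(j, entry \<alpha> j) | j. j \<in> {1..length \<alpha>} \<and> entry \<alpha> j > length \<alpha>}"
      using entry_ideal_tableau(1)[OF r m] maximals_snd[OF n J m] r P len a rt by auto
  next
    fix p assume "p \<in> {(j, entry \<alpha> j) | j. j \<in> {1..length \<alpha>} \<and> entry \<alpha> j > length \<alpha>}"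
    then obtain j where j: "p = (j, entry \<alpha> j)" "j \<in> {1..length \<alpha>}" "entry \<alpha> j > length \<alpha>"
      by blast
    then have m: "p \<in> maximals J" using ideal_tableau_entry_gt[OF n J, of j] len a by simp
    then have "p \<in> poset_P n" using J_P[OF n J] by (auto simp: maximals_def)
    then show "p \<in> maximals J \<inter> V_c n" using m j by (auto simp: V_c_def)
  qed
  ultimately show ?thesis by (simp add: set_K_def J_def)
qed

definition theta_exp :: "nat \<Rightarrow> nat list \<Rightarrow> theta_var \<Rightarrow>\<^sub>0 nat" where
  "theta_exp n b = Poly_Mapping.single Z_t 1 +
     (\<Sum>p \<in> set_K n (\<iota> n b). Poly_Mapping.single (Z_P p) 1)"

definition psi_exp :: "nat list \<Rightarrow> psi_var \<Rightarrow>\<^sub>0 nat" where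
  "psi_exp \<alpha> = Poly_Mapping.single (Z_single (length \<alpha>)) 1 +
     (\<Sum>j \<in> {j \<in> {1..length \<alpha>}. entry \<alpha> j > length \<alpha>}.
        Poly_Mapping.single (Z_pair j (entry \<alpha> j)) 1)"

lemma lookup_psi_exp:
  "Poly_Mapping.lookup (psi_exp \<alpha>) (Z_single k) = of_bool (length \<alpha> = k)"
  "Poly_Mapping.lookup (psi_exp \<alpha>) (Z_pair r s) =
     of_bool (r \<in> {1..length \<alpha>} \<and> s = entry \<alpha> r \<and> s > length \<alpha>)"
proof -
  show "Poly_Mapping.lookup (psi_exp \<alpha>) (Z_single k) = of_bool (length \<alpha> = k)"
    by (simp add: psi_exp_def lookup_add lookup_sum lookup_single when_def)
  let ?A = "{j \<in> {1..length \<alpha>}. entry \<alpha> j > length \<alpha>}"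
  \<comment> \<open>The summands are rewritten as a delta in \<open>j\<close>, so that only
    \<open>j = r\<close> survives; the 0 comes from the \<open>Z_single\<close> factor.\<close>
  have "Poly_Mapping.lookup (psi_exp \<alpha>) (Z_pair r s) =
      0 + (\<Sum>j\<in>?A. if j = r then of_bool (s = entry \<alpha> r) else 0)"
    unfolding psi_exp_def lookup_add lookup_sum lookup_single when_def
    by (intro arg_cong2[where f = "(+)"] sum.cong refl) auto
  also have "\<dots> = of_bool (r \<in> {1..length \<alpha>} \<and> s = entry \<alpha> r \<and> s > length \<alpha>)"
    unfolding add_0 by (subst sum.delta) auto
  finally show "Poly_Mapping.lookup (psi_exp \<alpha>) (Z_pair r s) =
     of_bool (r \<in> {1..length \<alpha>} \<and> s = entry \<alpha> r \<and> s > length \<alpha>)" .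
qed

lemma lookup_theta_exp:
  assumes "n \<ge> 2" "\<alpha> \<in> symbols_N n"
  shows "Poly_Mapping.lookup (theta_exp n \<alpha>) Z_t = 1"
    "Poly_Mapping.lookup (theta_exp n \<alpha>) (Z_P (r, s)) =
       of_bool (r = s \<and> 2 \<le> r \<and> r \<le> length \<alpha> \<or>
         r \<in> {1..length \<alpha>} \<and> s = entry \<alpha> r \<and> s > length \<alpha>)"
proof -
  show "Poly_Mapping.lookup (theta_exp n \<alpha>) Z_t = 1"
    by (simp add: theta_exp_def lookup_add lookup_sum lookup_single)
  have "Poly_Mapping.lookup (theta_exp n \<alpha>) (Z_P (r, s)) =
      of_bool ((r, s) \<in> set_K n (\<iota> n \<alpha>))"
    by (simp add: theta_exp_def lookup_add lookup_sum lookup_single when_def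
        finite_set_K)
  then show "Poly_Mapping.lookup (theta_exp n \<alpha>) (Z_P (r, s)) =
       of_bool (r = s \<and> 2 \<le> r \<and> r \<le> length \<alpha> \<or>
         r \<in> {1..length \<alpha>} \<and> s = entry \<alpha> r \<and> s > length \<alpha>)"
    unfolding set_K_\<iota>[OF assms] by auto
qed

section \<open>Linear relations between the two exponent vectors\<close>

context
  fixes n :: nat
  assumes n: "n \<ge> 2"
begin

abbreviation "E\<theta> m \<equiv> Poly_Mapping.lookup (monom_exp (\<lambda>i. theta_exp n (pbw_tableau n i)) m)"
abbreviation "E\<psi> m \<equiv> Poly_Mapping.lookup (monom_exp (\<lambda>i. psi_exp (pbw_tableau n i)) m)"

context
  fixes m :: "nat list \<Rightarrow>\<^sub>0 nat"
  assumes m: "Poly_Mapping.keys m \<subseteq> pluecker_index n"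
begin

lemma pbw_tableau_key_in_N: "i \<in> Poly_Mapping.keys m \<Longrightarrow> pbw_tableau n i \<in> symbols_N n"
  using m pbw_tableau_in_N by blast

text \<open>Every tableau has exactly one length in \<open>1..n-1\<close>, so its single factor
  \<open>t\<close> is counted once on the right.\<close>

lemma E\<theta>_t: "E\<theta> m Z_t = (\<Sum>k=1..n-1. E\<psi> m (Z_single k))"
  unfolding lookup_monom_exp
  by (subst sum.swap, intro sum.cong refl)
    (use pbw_tableau_key_in_N in \<open>auto simp: lookup_theta_exp[OF n] lookup_psi_exp symbols_N_def
      simp flip: sum_distrib_left\<close>)

text \<open>A tableau contributes to the diagonal variable at \<open>r\<close> exactly when its
  length is at least \<open>r\<close>. For \<open>r > n - 1\<close> both sides vanish.\<close>

lemma E\<theta>_diag: "2 \<le> r \<Longrightarrow> E\<theta> m (Z_P (r, r)) = (\<Sum>k=r..n-1. E\<psi> m (Z_single k))"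
  unfolding lookup_monom_exp
  by (subst sum.swap, intro sum.cong refl)
    (use pbw_tableau_key_in_N in \<open>auto simp: lookup_theta_exp[OF n] lookup_psi_exp symbols_N_def
      simp flip: sum_distrib_left\<close>)

lemma E\<theta>_pair: "r < s \<Longrightarrow> E\<theta> m (Z_P (r, s)) = E\<psi> m (Z_pair r s)"
  unfolding lookup_monom_exp
  by (intro sum.cong refl) (use pbw_tableau_key_in_N in \<open>auto simp: lookup_theta_exp[OF n] lookup_psi_exp\<close>)

text \<open>The variable types admit arbitrary natural indices, so indices outside the problem must
  be compared as well; here and in \<open>E\<psi>_0\<close> their exponents are zero.\<close>

lemma E\<theta>_0: "s < r \<or> r = s \<and> r < 2 \<Longrightarrow> E\<theta> m (Z_P (r, s)) = 0"
  unfolding lookup_monom_exp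
  by (intro sum.neutral) (use pbw_tableau_key_in_N in \<open>auto simp: lookup_theta_exp[OF n]\<close>)

lemma E\<psi>_0: "s \<le> r \<Longrightarrow> E\<psi> m (Z_pair r s) = 0" "k < 1 \<or> n - 1 < k \<Longrightarrow> E\<psi> m (Z_single k) = 0"
  unfolding lookup_monom_exp
  by (intro sum.neutral; use pbw_tableau_key_in_N in \<open>force simp: lookup_psi_exp symbols_N_def\<close>)+

text \<open>Splitting off the first summand, in additive form to avoid subtraction on naturals, lets
  the exponent of \<open>Z_single 1\<close> be recovered by cancellation.
  \<open>E\<theta>_diag_step\<close> does the same for larger indices.\<close>

lemma E\<theta>_t_step: "E\<theta> m Z_t = E\<psi> m (Z_single 1) + E\<theta> m (Z_P (2, 2))"
  using n by (simp add: E\<theta>_t E\<theta>_diag sum.atLeast_Suc_atMost numeral_2_eq_2)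

lemma E\<theta>_diag_step:
  assumes "2 \<le> k"
  shows "E\<theta> m (Z_P (k, k)) = E\<psi> m (Z_single k) + E\<theta> m (Z_P (Suc k, Suc k))"
proof (cases "k \<le> n - 1")
  case True
  then show ?thesis using assms by (simp add: E\<theta>_diag sum.atLeast_Suc_atMost)
next
  case False
  then show ?thesis using assms by (simp add: E\<theta>_diag E\<psi>_0)
qed

end

lemma monom_exp_eq_iff:
  assumes m: "Poly_Mapping.keys m \<subseteq> pluecker_index n" "Poly_Mapping.keys m' \<subseteq> pluecker_index n"
  shows "monom_exp (\<lambda>i. psi_exp (pbw_tableau n i)) m = monom_exp (\<lambda>i. psi_exp (pbw_tableau n i)) m' \<longleftrightarrow>
    monom_exp (\<lambda>i. theta_exp n (pbw_tableau n i)) m = monom_exp (\<lambda>i. theta_exp n (pbw_tableau n i)) m'"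
    (is "?l \<longleftrightarrow> ?r")
proof
  assume l: ?l
  show ?r
  proof (rule poly_mapping_eqI)
    fix w show "E\<theta> m w = E\<theta> m' w"
    proof (cases w)
      case Z_t
      then show ?thesis using l by (simp add: E\<theta>_t[OF m(1)] E\<theta>_t[OF m(2)])
    next
      case (Z_P p)
      obtain r s where p: "p = (r, s)" by fastforce
      consider "r < s" | "r = s" "2 \<le> r" | "s < r \<or> r = s \<and> r < 2" by linarith
      then show ?thesis
        using l Z_P p
        by cases (simp_all add: E\<theta>_pair m E\<theta>_diag E\<theta>_0)
    qed
  qed
next
  assume r: ?r
  show ?l
  proof (rule poly_mapping_eqI)
    fix w show "E\<psi> m w = E\<psi> m' w"
    proof (cases w)
      case (Z_pair a b)
      show ?thesis
      proof (cases "a < b")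
        case True
        then show ?thesis using r Z_pair by (simp flip: E\<theta>_pair[OF m(1)] E\<theta>_pair[OF m(2)])
      next
        case False
        then show ?thesis using Z_pair by (simp add: E\<psi>_0 m)
      qed
    next
      case (Z_single k)
      consider "k = 0" | "k = 1" | "2 \<le> k" by linarith
      then show ?thesis
      proof cases
        case 1
        then show ?thesis using Z_single by (simp add: E\<psi>_0 m)
      next
        case 2
        then show ?thesis
          using E\<theta>_t_step[OF m(1)] E\<theta>_t_step[OF m(2)] r Z_single by simp
      next
        case 3
        then show ?thesis
          using E\<theta>_diag_step[OF m(1) 3] E\<theta>_diag_step[OF m(2) 3] r Z_single by simp
      qed
    qed
  qed
qed

end

section \<open>Equality of the kernels\<close>

text \<open>The Pluecker sign becomes the coefficient of a single monomial. It is the same in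
  \<open>\<psi>_eq_subst\<close>, which supplies the common \<open>c\<close> of
  \<open>poly_subst_single_eq_0_iff\<close>.\<close>

lemma \<theta>_eq_subst:
  "\<theta> n = poly_subst (\<lambda>i. Poly_Mapping.single (theta_exp n (pbw_tableau n i))
     (of_int (sgn_list (pbw_tableau n i))))"
  unfolding \<theta>_def R_hom_def theta_exp_def
  by (simp add: prod_Var finite_set_K Var_def[of Z_t] mult_single of_int_mult_single)

lemma \<psi>_eq_subst:
  "\<psi> n = poly_subst (\<lambda>i. Poly_Mapping.single (psi_exp (pbw_tableau n i))
     (of_int (sgn_list (pbw_tableau n i))))"
  unfolding \<psi>_def R_hom_def psi_exp_def
  by (simp add: prod_Var Var_def[of "Z_single _"] mult_single of_int_mult_single)

theorem theorem6p9:
  fixes n :: nat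
  assumes "n \<ge> 2"
  shows "I_fflv n = I_Vo_Vc n"
proof -
  have "\<psi> n p = 0 \<longleftrightarrow> \<theta> n p = 0" if "p \<in> ring_R n" for p
    unfolding \<psi>_eq_subst \<theta>_eq_subst
    \<comment> \<open>Membership in \<open>ring_R\<close> confines the variables of each monomial to
      \<open>pluecker_index n\<close>, as \<open>monom_exp_eq_iff\<close> requires.\<close>
    by (rule poly_subst_single_eq_0_iff, rule monom_exp_eq_iff[OF assms])
      (use that in \<open>auto simp: ring_R_def polys_in_def\<close>)
  then show ?thesis by (auto simp: I_fflv_def I_Vo_Vc_def R_kernel_def)
qed

end
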